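(* Let $\epsilon\ge 0$ and let $(\mathbb{X},\mathbb{p})$ and $(\mathbb{Y},\mathbb{q})$ be two vector bundle filtrations of dimension $d$ on a Euclidean space, with respective index sets $T$ and $U$, where $\mathbb{X}=(X^t)_{t\in T}$ and $\mathbb{Y}=(Y^t)_{t\in U}$. Suppose that they are $\epsilon$-interleaved. Then there exists an $\epsilon$-interleaving $(\phi,\psi)$ between their persistent cohomology modules, with $\phi=(\phi^t\colon H^*(Y^t)\to H^*(X^{t-\epsilon}))_{t\in(T+\epsilon)\cap U}$ and $\psi=(\psi^s\colon H^*(X^s)\to H^*(Y^{s-\epsilon}))_{s\in(U+\epsilon)\cap T}$, which sends persistent Stiefel-Whitney classes to persistent Stiefel-Whitney classes: for every $i\in\{1,\dots,d\}$, every $t\in(T+\epsilon)\cap U$ and every $s\in(U+\epsilon)\cap T$, $$\phi^t\big(w_i^t(\mathbb{q})\big)=w_i^{t-\epsilon}(\mathbb{p})\qquad\text{and}\qquad \psi^s\big(w_i^s(\mathbb{p})\big)=w_i^{s-\epsilon}(\mathbb{q}).$$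
   Context: $H^*$ is singular cohomology with $\mathbb{Z}/2$ coefficients. Index sets are intervals of $[0,+\infty)$ containing $0$. $\mathcal{G}_d(\mathbb{R}^\infty)$ is the infinite Grassmannian of $d$-planes; $H^*(\mathcal{G}_d(\mathbb{R}^\infty))\cong(\mathbb{Z}/2)[w_1,\dots,w_d]$, where $w_i$ is the $i$-th Stiefel-Whitney class of the tautological bundle. A filtration of a Euclidean space $E$ is a family $(X^t)_{t\in T}$ of subsets with $X^s\subseteq X^t$ for $s\le t$. A vector bundle filtration of dimension $d$ on $E$ is a pair $(\mathbb{X},\mathbb{p})$ with $\mathbb{X}=(X^t)_{t\in T}$ a filtration of $E$ and $\mathbb{p}=(p^t)_{t\in T}$ a family of continuous maps $p^t\colon X^t\to\mathcal{G}_d(\mathbb{R}^\infty)$ such that the restriction of $p^t$ to $X^s$ is $p^s$ whenever $s\le t$. Its $i$-th persistent Stiefel-Whitney class is the family $w_i(\mathbb{p})=(w_i^t(\mathbb{p}))_{t\in T}$ with $w_i^t(\mathbb{p})=(p^t)^*(w_i)\in H^i(X^t)$. Its persistent cohomology module is the family $(H^*(X^t))_{t\in T}$ with the restriction maps $H^*(X^t)\to H^*(X^s)$, $s\le t$, induced by inclusions. Two vector bundle filtrations $(\mathbb{X},\mathbb{p})$ (index set $T$) and $(\mathbb{Y},\mathbb{q})$ (index set $U$) on $E$ are $\epsilon$-interleaved if: for every $t\in T\cap(U-\epsilon)$, $X^t\subseteq Y^{t+\epsilon}$ and $q^{t+\epsilon}|_{X^t}=p^t$; and for every $s\in U\cap(T-\epsilon)$,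 $Y^s\subseteq X^{s+\epsilon}$ and $p^{s+\epsilon}|_{Y^s}=q^s$. An $\epsilon$-interleaving between the persistent cohomology modules is a pair of families of linear maps $\phi^t\colon H^*(Y^t)\to H^*(X^{t-\epsilon})$ ($t\in(T+\epsilon)\cap U$) and $\psi^s\colon H^*(X^s)\to H^*(Y^{s-\epsilon})$ ($s\in(U+\epsilon)\cap T$) which commute with the restriction maps of the two modules and are such that, whenever the maps are defined, $\phi^{t-\epsilon}\circ\psi^{t}\colon H^*(X^t)\to H^*(X^{t-2\epsilon})$ and $\psi^{t-\epsilon}\circ\phi^t\colon H^*(Y^t)\to H^*(Y^{t-2\epsilon})$ are the restriction maps. *)

theory Defs
  imports "HOL-Homology.Homology" "HOL-Library.Z2" "HOL-Analysis.Finite_Function_Topology"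
begin

section \<open>Singular cohomology with coefficients in \<open>\<int>/2\<close>\<close>

text \<open>
  A \<open>p\<close>-cochain of \<open>X\<close> with values in \<open>\<int>/2\<close> (the field \<^typ>\<open>bit\<close>) is a homomorphism from the
  singular chain group to \<open>\<int>/2\<close>, i.e. an arbitrary function on the singular simplices of \<open>X\<close>.
  It is extended by 0 to all functions that are not singular simplices, so that equality of
  cochains is equality of functions.
\<close>

type_synonym 'a cochain = "((nat \<Rightarrow> real) \<Rightarrow> 'a) \<Rightarrow> bit"

definition cochains :: "nat \<Rightarrow> 'a topology \<Rightarrow> 'a cochain set"
  where "cochains p X = {c. \<forall>\<sigma>. \<not> singular_simplex p X \<sigma> \<longrightarrow> c \<sigma> = 0}"

definition cochain_group :: "nat \<Rightarrow> 'a topology \<Rightarrow> 'a cochain monoid"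
  where "cochain_group p X =
    \<lparr>carrier = cochains p X, monoid.mult = (\<lambda>a b \<sigma>. a \<sigma> + b \<sigma>), one = (\<lambda>\<sigma>. 0)\<rparr>"

text \<open>The dual of \<^const>\<open>chain_boundary\<close>; the signs disappear modulo 2.\<close>

definition coboundary :: "nat \<Rightarrow> 'a topology \<Rightarrow> 'a cochain \<Rightarrow> 'a cochain"
  where "coboundary p X c = (\<lambda>\<sigma>. if singular_simplex (Suc p) X \<sigma>
                                  then \<Sum>k\<le>Suc p. c (singular_face (Suc p) k \<sigma>) else 0)"

definition cocycle_group :: "nat \<Rightarrow> 'a topology \<Rightarrow> 'a cochain monoid"
  where "cocycle_group p X =
    (cochain_group p X)\<lparr>carrier := {c \<in> cochains p X. coboundary p X c = (\<lambda>\<sigma>. 0)}\<rparr>"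

definition coboundaries :: "nat \<Rightarrow> 'a topology \<Rightarrow> 'a cochain set"
  where "coboundaries p X = (case p of 0 \<Rightarrow> {\<lambda>\<sigma>. 0} | Suc q \<Rightarrow> coboundary q X ` cochains q X)"

definition cohomology_group :: "nat \<Rightarrow> 'a topology \<Rightarrow> 'a cochain set monoid"
  where "cohomology_group p X = cocycle_group p X Mod coboundaries p X"

text \<open>
  Cohomology classes are cosets of the group of coboundaries. An operation on cochains is carried
  over to classes by applying it to all representatives and closing up under the addition of
  coboundaries, for which the following notation is used.
\<close>

definition coboundary_hull :: "nat \<Rightarrow> 'a topology \<Rightarrow> 'a cochain set \<Rightarrow> 'a cochain set"
  where "coboundary_hull p X A = coboundaries p X <#>\<^bsub>cochain_group p X\<^esub> A"

definition cohomology_scale :: "nat \<Rightarrow> 'a topology \<Rightarrow> bit \<Rightarrow> 'a cochain set \<Rightarrow> 'a cochain set"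
  where "cohomology_scale p X r A = coboundary_hull p X ((\<lambda>c \<sigma>. r * c \<sigma>) ` A)"

definition cochain_pullback :: "nat \<Rightarrow> 'a topology \<Rightarrow> ('a \<Rightarrow> 'b) \<Rightarrow> 'b cochain \<Rightarrow> 'a cochain"
  where "cochain_pullback p X f c =
    (\<lambda>\<sigma>. if singular_simplex p X \<sigma> then c (simplex_map p f \<sigma>) else 0)"

text \<open>
  The map \<open>f\<^sup>* : H\<^sup>p(Y) \<rightarrow> H\<^sup>p(X)\<close> induced by a continuous \<open>f : X \<rightarrow> Y\<close>; only the source \<open>X\<close> of \<open>f\<close>
  occurs as an argument.
\<close>

definition cohomology_induced ::
    "nat \<Rightarrow> 'a topology \<Rightarrow> ('a \<Rightarrow> 'b) \<Rightarrow> 'b cochain set \<Rightarrow> 'a cochain set"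
  where "cohomology_induced p X f A = coboundary_hull p X (cochain_pullback p X f ` A)"

definition cohomology :: "'a topology \<Rightarrow> (nat \<Rightarrow> 'a cochain set) monoid"
  where "cohomology X = sum_group UNIV (\<lambda>p. cohomology_group p X)"

definition induced_map ::
    "'a topology \<Rightarrow> ('a \<Rightarrow> 'b) \<Rightarrow> (nat \<Rightarrow> 'b cochain set) \<Rightarrow> nat \<Rightarrow> 'a cochain set"
  where "induced_map X f x = (\<lambda>p. cohomology_induced p X f (x p))"

definition scale :: "'a topology \<Rightarrow> bit \<Rightarrow> (nat \<Rightarrow> 'a cochain set) \<Rightarrow> nat \<Rightarrow> 'a cochain set"
  where "scale X r x = (\<lambda>p. cohomology_scale p X r (x p))"

definition in_degree :: "nat \<Rightarrow> 'a topology \<Rightarrow> 'a cochain set \<Rightarrow> nat \<Rightarrow> 'a cochain set"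
  where "in_degree p X A = (\<lambda>j. if j = p then A else \<one>\<^bsub>cohomology_group j X\<^esub>)"

definition cohomology_linear ::
    "'a topology \<Rightarrow> 'b topology \<Rightarrow> ((nat \<Rightarrow> 'a cochain set) \<Rightarrow> nat \<Rightarrow> 'b cochain set) \<Rightarrow> bool"
  where "cohomology_linear X Y f \<longleftrightarrow>
    f \<in> hom (cohomology X) (cohomology Y) \<and>
    (\<forall>r. \<forall>x\<in>carrier (cohomology X). f (scale X r x) = scale Y r (f x))"


section \<open>Cup products\<close>

text \<open>
  Alexander--Whitney: the front \<open>p\<close>-face is spanned by the vertices \<open>0, \<dots>, p\<close> and the back
  \<open>q\<close>-face by the vertices \<open>p, \<dots>, p + q\<close>.
\<close>

definition front_face :: "nat \<Rightarrow> ((nat \<Rightarrow> real) \<Rightarrow> 'a) \<Rightarrow> (nat \<Rightarrow> real) \<Rightarrow> 'a"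
  where "front_face p \<sigma> = restrict \<sigma> (standard_simplex p)"

definition back_face :: "nat \<Rightarrow> nat \<Rightarrow> ((nat \<Rightarrow> real) \<Rightarrow> 'a) \<Rightarrow> (nat \<Rightarrow> real) \<Rightarrow> 'a"
  where "back_face p q \<sigma> =
    restrict (\<lambda>x. \<sigma> (\<lambda>i. if i < p then 0 else x (i - p))) (standard_simplex q)"

definition cochain_cup :: "nat \<Rightarrow> nat \<Rightarrow> 'a topology \<Rightarrow> 'a cochain \<Rightarrow> 'a cochain \<Rightarrow> 'a cochain"
  where "cochain_cup p q X a b =
    (\<lambda>\<sigma>. if singular_simplex (p + q) X \<sigma> then a (front_face p \<sigma>) * b (back_face p q \<sigma>) else 0)"

definition cup ::
    "nat \<Rightarrow> nat \<Rightarrow> 'a topology \<Rightarrow> 'a cochain set \<Rightarrow> 'a cochain set \<Rightarrow> 'a cochain set"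
  where "cup p q X A B = coboundary_hull (p + q) X {cochain_cup p q X a b | a b. a \<in> A \<and> b \<in> B}"

definition unit_class :: "'a topology \<Rightarrow> 'a cochain set"
  where "unit_class X =
    coboundary_hull 0 X {\<lambda>\<sigma>. if singular_simplex 0 X \<sigma> then 1 else 0}"

fun cup_power :: "'a topology \<Rightarrow> 'a cochain set \<Rightarrow> nat \<Rightarrow> 'a cochain set"
  where
    "cup_power X A 0 = unit_class X"
  | "cup_power X A (Suc k) = cup 1 k X A (cup_power X A k)"


section \<open>The infinite Grassmannian\<close>

definition final_topology ::
    "'i set \<Rightarrow> ('i \<Rightarrow> 'a topology) \<Rightarrow> ('i \<Rightarrow> 'a \<Rightarrow> 'b) \<Rightarrow> 'b set \<Rightarrow> 'b topology"
  where "final_topology I X f S =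
    topology (\<lambda>U. U \<subseteq> S \<and> (\<forall>i\<in>I. openin (X i) {x \<in> topspace (X i). f i x \<in> U}))"

lemma openin_final_topology:
  "openin (final_topology I X f S) U \<longleftrightarrow>
     U \<subseteq> S \<and> (\<forall>i\<in>I. openin (X i) {x \<in> topspace (X i). f i x \<in> U})"
proof -
  have "istopology (\<lambda>U. U \<subseteq> S \<and> (\<forall>i\<in>I. openin (X i) {x \<in> topspace (X i). f i x \<in> U}))"
    unfolding istopology_def
  proof (intro conjI allI impI ballI; (elim conjE)?)
    fix A B i
    assume "\<forall>i\<in>I. openin (X i) {x \<in> topspace (X i). f i x \<in> A}"
      and "\<forall>i\<in>I. openin (X i) {x \<in> topspace (X i). f i x \<in> B}" and "i \<in> I"
    moreover have "{x \<in> topspace (X i). f i x \<in> A \<inter> B} =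
        {x \<in> topspace (X i). f i x \<in> A} \<inter> {x \<in> topspace (X i). f i x \<in> B}"
      by blast
    ultimately show "openin (X i) {x \<in> topspace (X i). f i x \<in> A \<inter> B}"
      by (simp add: openin_Int)
  next
    fix \<K> i
    assume *: "\<forall>K\<in>\<K>. K \<subseteq> S \<and> (\<forall>i\<in>I. openin (X i) {x \<in> topspace (X i). f i x \<in> K})"
      and "i \<in> I"
    have "{x \<in> topspace (X i). f i x \<in> \<Union>\<K>} = (\<Union>K\<in>\<K>. {x \<in> topspace (X i). f i x \<in> K})"
      by blast
    then show "openin (X i) {x \<in> topspace (X i). f i x \<in> \<Union>\<K>}"
      using * \<open>i \<in> I\<close> by (auto intro!: openin_Union)
  qed blast+
  then show ?thesis
    by (simp add: final_topology_def topology_inverse')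
qed

text \<open>
  \<open>\<real>\<^sup>\<infinity>\<close> is the space \<^typ>\<open>nat \<Rightarrow>\<^sub>0 real\<close> of finitely supported sequences, and \<open>\<real>\<^sup>n\<close> is its subspace
  of sequences supported in \<open>{0, \<dots>, n - 1}\<close>. On \<open>\<real>\<^sup>n\<close> the norm topology of \<^typ>\<open>nat \<Rightarrow>\<^sub>0 real\<close> is
  the Euclidean one. \<open>\<G>\<^sub>d(\<real>\<^sup>n)\<close> is a quotient of the space of \<open>d\<close>-frames in \<open>\<real>\<^sup>n\<close>, and \<open>\<G>\<^sub>d(\<real>\<^sup>\<infinity>)\<close> is
  the direct limit of the spaces \<open>\<G>\<^sub>d(\<real>\<^sup>n)\<close>; the norm topology of \<open>\<real>\<^sup>\<infinity>\<close> as a whole plays no role.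
\<close>

definition coordinate_space :: "nat \<Rightarrow> (nat \<Rightarrow>\<^sub>0 real) set"
  where "coordinate_space n = {v. Poly_Mapping.keys v \<subseteq> {..<n}}"

definition frame_space :: "nat \<Rightarrow> nat \<Rightarrow> (nat \<Rightarrow> (nat \<Rightarrow>\<^sub>0 real)) topology"
  where "frame_space d n =
    subtopology (product_topology (\<lambda>_. top_of_set (coordinate_space n)) {..<d})
      {e. inj_on e {..<d} \<and> independent (e ` {..<d})}"

definition finite_grassmannian :: "nat \<Rightarrow> nat \<Rightarrow> (nat \<Rightarrow>\<^sub>0 real) set topology"
  where "finite_grassmannian d n =
    final_topology {()} (\<lambda>_. frame_space d n) (\<lambda>_ e. span (e ` {..<d}))
      {V. subspace V \<and> V \<subseteq> coordinate_space n \<and> dim V = d}"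

definition grassmannian :: "nat \<Rightarrow> (nat \<Rightarrow>\<^sub>0 real) set topology"
  where "grassmannian d =
    final_topology UNIV (finite_grassmannian d) (\<lambda>_ V. V)
      {V. subspace V \<and> (\<exists>n. V \<subseteq> coordinate_space n) \<and> dim V = d}"


section \<open>Stiefel--Whitney classes of the tautological bundle\<close>

text \<open>
  The Stiefel--Whitney classes are defined by Grothendieck's method. The projectivisation \<open>P\<close> of
  the tautological bundle of \<open>\<G>\<^sub>d(\<real>\<^sup>\<infinity>)\<close> consists of the pairs \<open>(V, L)\<close> of a \<open>d\<close>-plane \<open>V\<close> and a line
  \<open>L \<subseteq> V\<close>. Let \<open>\<pi> : P \<rightarrow> \<G>\<^sub>d(\<real>\<^sup>\<infinity>)\<close> and \<open>P \<rightarrow> \<G>\<^sub>1(\<real>\<^sup>\<infinity>) = \<real>P\<^sup>\<infinity>\<close> be the two projections, and let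
  \<open>x \<in> H\<^sup>1(P)\<close> be the pullback of the generator of \<open>H\<^sup>1(\<real>P\<^sup>\<infinity>) \<cong> \<int>/2\<close>. By the Leray--Hirsch theorem
  \<open>1, x, \<dots>, x\<^bsup>d - 1\<^esup>\<close> is a basis of \<open>H\<^sup>*(P)\<close> over \<open>H\<^sup>*(\<G>\<^sub>d(\<real>\<^sup>\<infinity>))\<close>, so there are unique classes \<open>w\<^sub>i\<close> of
  degree \<open>i\<close> with \<open>w\<^sub>0 = 1\<close> and
  \<open>x\<^sup>d + \<pi>\<^sup>*(w\<^sub>1) x\<^bsup>d - 1\<^esup> + \<dots> + \<pi>\<^sup>*(w\<^sub>d) = 0\<close>.
\<close>

definition projectivised_tautological ::
    "nat \<Rightarrow> ((nat \<Rightarrow>\<^sub>0 real) set \<times> (nat \<Rightarrow>\<^sub>0 real) set) topology"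
  where "projectivised_tautological d =
    subtopology (prod_topology (grassmannian d) (grassmannian 1)) {(V, L). L \<subseteq> V}"

definition line_generator :: "(nat \<Rightarrow>\<^sub>0 real) set cochain set"
  where "line_generator = (THE x. x \<in> carrier (cohomology_group 1 (grassmannian 1)) \<and>
                                   x \<noteq> \<one>\<^bsub>cohomology_group 1 (grassmannian 1)\<^esub>)"

definition is_stiefel_whitney :: "nat \<Rightarrow> (nat \<Rightarrow> (nat \<Rightarrow>\<^sub>0 real) set cochain set) \<Rightarrow> bool"
  where "is_stiefel_whitney d w \<longleftrightarrow>
    (let G = grassmannian d; P = projectivised_tautological d;
         x = cohomology_induced 1 P snd line_generator
     in (\<forall>i. w i \<in> carrier (cohomology_group i G)) \<and>
        w 0 = unit_class G \<and>
        (\<forall>i>d. w i = \<one>\<^bsub>cohomology_group i G\<^esub>) \<and>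
        (\<Otimes>\<^bsub>cohomology_group d P\<^esub>i\<in>{..d}.
           cup i (d - i) P (cohomology_induced i P fst (w i)) (cup_power P x (d - i)))
          = \<one>\<^bsub>cohomology_group d P\<^esub>)"

definition stiefel_whitney :: "nat \<Rightarrow> nat \<Rightarrow> (nat \<Rightarrow>\<^sub>0 real) set cochain set"
  where "stiefel_whitney d = (THE w. is_stiefel_whitney d w)"


section \<open>Vector bundle filtrations\<close>

definition index_interval :: "real set \<Rightarrow> bool"
  where "index_interval T \<longleftrightarrow> is_interval T \<and> T \<subseteq> {0..} \<and> 0 \<in> T"

text \<open>Families indexed by \<open>T\<close> are total functions on \<^typ>\<open>real\<close>; only their values on \<open>T\<close> are used.\<close>

definition filtration :: "real set \<Rightarrow> (real \<Rightarrow> 'e::euclidean_space set) \<Rightarrow> bool"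
  where "filtration T X \<longleftrightarrow> (\<forall>s\<in>T. \<forall>t\<in>T. s \<le> t \<longrightarrow> X s \<subseteq> X t)"

definition vector_bundle_filtration ::
    "nat \<Rightarrow> real set \<Rightarrow> (real \<Rightarrow> 'e::euclidean_space set) \<Rightarrow>
     (real \<Rightarrow> 'e \<Rightarrow> (nat \<Rightarrow>\<^sub>0 real) set) \<Rightarrow> bool"
  where "vector_bundle_filtration d T X p \<longleftrightarrow>
    index_interval T \<and> filtration T X \<and>
    (\<forall>t\<in>T. continuous_map (top_of_set (X t)) (grassmannian d) (p t)) \<and>
    (\<forall>s\<in>T. \<forall>t\<in>T. s \<le> t \<longrightarrow> (\<forall>x\<in>X s. p t x = p s x))"

text \<open>
  The class \<open>w\<^sub>i\<^sup>t(p) = (p\<^sup>t)\<^sup>*(w\<^sub>i) \<in> H\<^sup>i(X\<^sup>t)\<close>, regarded as an element of \<open>H\<^sup>*(X\<^sup>t)\<close>.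
\<close>

definition persistent_stiefel_whitney ::
    "nat \<Rightarrow> (real \<Rightarrow> 'e::euclidean_space set) \<Rightarrow> (real \<Rightarrow> 'e \<Rightarrow> (nat \<Rightarrow>\<^sub>0 real) set) \<Rightarrow>
     nat \<Rightarrow> real \<Rightarrow> nat \<Rightarrow> 'e cochain set"
  where "persistent_stiefel_whitney d X p i t =
    in_degree i (top_of_set (X t))
      (cohomology_induced i (top_of_set (X t)) (p t) (stiefel_whitney d i))"

definition interleaved ::
    "real \<Rightarrow> real set \<Rightarrow> (real \<Rightarrow> 'e::euclidean_space set) \<Rightarrow> (real \<Rightarrow> 'e \<Rightarrow> (nat \<Rightarrow>\<^sub>0 real) set) \<Rightarrow>
     real set \<Rightarrow> (real \<Rightarrow> 'e set) \<Rightarrow> (real \<Rightarrow> 'e \<Rightarrow> (nat \<Rightarrow>\<^sub>0 real) set) \<Rightarrow> bool"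
  where "interleaved \<epsilon> T X p U Y q \<longleftrightarrow>
    (\<forall>t \<in> T \<inter> (\<lambda>u. u - \<epsilon>) ` U. X t \<subseteq> Y (t + \<epsilon>) \<and> (\<forall>x \<in> X t. q (t + \<epsilon>) x = p t x)) \<and>
    (\<forall>s \<in> U \<inter> (\<lambda>t. t - \<epsilon>) ` T. Y s \<subseteq> X (s + \<epsilon>) \<and> (\<forall>y \<in> Y s. p (s + \<epsilon>) y = q s y))"

text \<open>The restriction map \<open>H\<^sup>*(X\<^sup>t) \<rightarrow> H\<^sup>*(X\<^sup>s)\<close> of the persistent cohomology module, for \<open>s \<le> t\<close>.\<close>

definition restriction_map ::
    "(real \<Rightarrow> 'e::euclidean_space set) \<Rightarrow> real \<Rightarrow> real \<Rightarrow>
     (nat \<Rightarrow> 'e cochain set) \<Rightarrow> nat \<Rightarrow> 'e cochain set"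
  where "restriction_map X t s = induced_map (top_of_set (X s)) id"

definition cohomology_interleaving ::
    "real \<Rightarrow> real set \<Rightarrow> (real \<Rightarrow> 'e::euclidean_space set) \<Rightarrow> real set \<Rightarrow> (real \<Rightarrow> 'e set) \<Rightarrow>
     (real \<Rightarrow> (nat \<Rightarrow> 'e cochain set) \<Rightarrow> nat \<Rightarrow> 'e cochain set) \<Rightarrow>
     (real \<Rightarrow> (nat \<Rightarrow> 'e cochain set) \<Rightarrow> nat \<Rightarrow> 'e cochain set) \<Rightarrow> bool"
  where "cohomology_interleaving \<epsilon> T X U Y \<phi> \<psi> \<longleftrightarrow>
    (\<forall>t \<in> (\<lambda>r. r + \<epsilon>) ` T \<inter> U.
       cohomology_linear (top_of_set (Y t)) (top_of_set (X (t - \<epsilon>))) (\<phi> t)) \<and>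
    (\<forall>s \<in> (\<lambda>r. r + \<epsilon>) ` U \<inter> T.
       cohomology_linear (top_of_set (X s)) (top_of_set (Y (s - \<epsilon>))) (\<psi> s)) \<and>
    (\<forall>t \<in> (\<lambda>r. r + \<epsilon>) ` T \<inter> U. \<forall>t' \<in> (\<lambda>r. r + \<epsilon>) ` T \<inter> U. t \<le> t' \<longrightarrow>
       (\<forall>y \<in> carrier (cohomology (top_of_set (Y t'))).
          \<phi> t (restriction_map Y t' t y) = restriction_map X (t' - \<epsilon>) (t - \<epsilon>) (\<phi> t' y))) \<and>
    (\<forall>s \<in> (\<lambda>r. r + \<epsilon>) ` U \<inter> T. \<forall>s' \<in> (\<lambda>r. r + \<epsilon>) ` U \<inter> T. s \<le> s' \<longrightarrow>
       (\<forall>x \<in> carrier (cohomology (top_of_set (X s'))).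
          \<psi> s (restriction_map X s' s x) = restriction_map Y (s' - \<epsilon>) (s - \<epsilon>) (\<psi> s' x))) \<and>
    (\<forall>t. t \<in> (\<lambda>r. r + \<epsilon>) ` U \<inter> T \<and> t - \<epsilon> \<in> (\<lambda>r. r + \<epsilon>) ` T \<inter> U \<longrightarrow>
       (\<forall>x \<in> carrier (cohomology (top_of_set (X t))).
          \<phi> (t - \<epsilon>) (\<psi> t x) = restriction_map X t (t - 2 * \<epsilon>) x)) \<and>
    (\<forall>t. t \<in> (\<lambda>r. r + \<epsilon>) ` T \<inter> U \<and> t - \<epsilon> \<in> (\<lambda>r. r + \<epsilon>) ` U \<inter> T \<longrightarrow>
       (\<forall>y \<in> carrier (cohomology (top_of_set (Y t))).
          \<psi> (t - \<epsilon>) (\<phi> t y) = restriction_map Y t (t - 2 * \<epsilon>) y))"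

end

theory Submission
  imports Defs
begin

text \<open>
  Since \<open>q\<^bsup>t\<^esup>\<close> restricts to \<open>p\<^bsup>t - \<epsilon>\<^esup>\<close> on \<open>X\<^bsup>t - \<epsilon>\<^esup>\<close>, the inclusions \<open>X\<^bsup>t - \<epsilon>\<^esup> \<subseteq> Y\<^bsup>t\<^esup>\<close> and
  \<open>Y\<^bsup>s - \<epsilon>\<^esup> \<subseteq> X\<^bsup>s\<^esup>\<close> induce the interleaving, and everything follows from functoriality of cohomology.
  Pulling back is functorial for arbitrary sets of cochains closed up under coboundaries, so no
  property of the classes \<open>w\<^sub>i\<close> is needed beyond their being sets of cochains of \<open>\<G>\<^sub>d(\<real>\<^sup>\<infinity>)\<close>.
\<close>

text \<open>
  By default the simplifier turns sums and products of bits into bit operations, which hides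
  the linear structure of cochains.
\<close>

declare add_bit_eq_xor [simp del] mult_bit_eq_and [simp del]

lemma bit_add_self [simp]: "(a::bit) + a = 0"
  by (cases a) simp_all

section \<open>Cohomology groups\<close>

lemma coboundary_mem_cochains: "coboundary p X c \<in> cochains (Suc p) X"
  by (simp add: coboundary_def cochains_def)

lemma coboundary_add:
  "coboundary p X (\<lambda>\<sigma>. a \<sigma> + b \<sigma>) = (\<lambda>\<sigma>. coboundary p X a \<sigma> + coboundary p X b \<sigma>)"
  by (rule ext) (simp add: coboundary_def sum.distrib del: sum.atMost_Suc)

lemma coboundary_zero [simp]: "coboundary p X (\<lambda>\<sigma>. 0) = (\<lambda>\<sigma>. 0)"
  by (auto simp: coboundary_def)

text \<open>The simplicial identity: both sides insert zero barycentric coordinates at the positions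
  \<open>i\<close> and \<open>Suc j\<close>. Writing the larger index as \<open>Suc j\<close> avoids
  predecessors.\<close>

lemma singular_face_singular_face:
  assumes "i \<le> j" "j \<le> Suc p"
  shows "singular_face (Suc p) i (singular_face (Suc (Suc p)) (Suc j) \<sigma>) =
         singular_face (Suc p) j (singular_face (Suc (Suc p)) i \<sigma>)"
proof
  fix t
  show "singular_face (Suc p) i (singular_face (Suc (Suc p)) (Suc j) \<sigma>) t =
        singular_face (Suc p) j (singular_face (Suc (Suc p)) i \<sigma>) t"
  proof (cases "t \<in> standard_simplex p")
    case True
    have "simplical_face i t \<in> standard_simplex (Suc p)"
      and "simplical_face j t \<in> standard_simplex (Suc p)"
      using assms True by (auto intro!: simplical_face_in_standard_simplex)
    moreover have "simplical_face (Suc j) (simplical_face i t) = simplical_face i (simplical_face j t)"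
      using assms(1) by (fastforce simp: simplical_face_def)
    ultimately show ?thesis
      using True by (simp add: singular_face_def)
  \<comment> \<open>Off the standard simplex both sides are \<open>undefined\<close>, by the
    \<open>restrict\<close> in \<open>singular_face\<close>.\<close>
  qed (simp add: singular_face_def)
qed

text \<open>The pairs \<open>(Suc j, i)\<close> and \<open>(i, j)\<close> with
  \<open>i \<le> j \<le> n\<close> exhaust the index set and carry equal terms, which cancel modulo
  2.\<close>

lemma simplicial_double_sum_eq_0:
  fixes F :: "nat \<Rightarrow> nat \<Rightarrow> bit"
  assumes "\<And>i j. i \<le> j \<Longrightarrow> j \<le> n \<Longrightarrow> F (Suc j) i = F i j"
  shows "(\<Sum>k\<le>Suc n. \<Sum>l\<le>n. F k l) = 0"
  using assms
proof (induction n)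
  case 0
  then show ?case by simp
next
  case (Suc n)
  \<comment> \<open>Enlarging \<open>n\<close> by one adds the column \<open>l = Suc n\<close> and
    the row \<open>k = Suc (Suc n)\<close>; the hypothesis at \<open>j = Suc n\<close> equates their
    sums.\<close>
  have "(\<Sum>k\<le>Suc (Suc n). \<Sum>l\<le>Suc n. F k l) =
      (\<Sum>k\<le>Suc n. \<Sum>l\<le>n. F k l) + ((\<Sum>k\<le>Suc n. F k (Suc n)) + (\<Sum>l\<le>Suc n. F (Suc (Suc n)) l))"
    by (simp only: sum.atMost_Suc[of _ "Suc n"] sum.atMost_Suc[of "F _" n] sum.distrib ac_simps)
  also have "(\<Sum>l\<le>Suc n. F (Suc (Suc n)) l) = (\<Sum>k\<le>Suc n. F k (Suc n))"
    using Suc.prems by (intro sum.cong) auto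
  finally show ?case
    using Suc.IH Suc.prems by (simp only: bit_add_self add_0_right)
qed

lemma coboundary_coboundary [simp]: "coboundary (Suc p) X (coboundary p X c) = (\<lambda>\<sigma>. 0)"
proof
  fix \<sigma>
  show "coboundary (Suc p) X (coboundary p X c) \<sigma> = 0"
  proof (cases "singular_simplex (Suc (Suc p)) X \<sigma>")
    case True
    \<comment> \<open>The guard of the inner \<open>coboundary\<close> has to hold on every face
      before the double sum appears.\<close>
    have "singular_simplex (Suc p) X (singular_face (Suc (Suc p)) k \<sigma>)" if "k \<le> Suc (Suc p)" for k
      using singular_simplex_singular_face[OF True] that by simp
    then have "coboundary (Suc p) X (coboundary p X c) \<sigma> =
        (\<Sum>k\<le>Suc (Suc p). \<Sum>l\<le>Suc p. c (singular_face (Suc p) l (singular_face (Suc (Suc p)) k \<sigma>)))"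
      unfolding coboundary_def using True by (simp del: sum.atMost_Suc)
    also have "\<dots> = 0"
      by (rule simplicial_double_sum_eq_0) (simp add: singular_face_singular_face)
    finally show ?thesis .
  qed (simp add: coboundary_def)
qed

section \<open>Cocycles, coboundaries and their quotient\<close>

lemma cochains_zero [simp]: "(\<lambda>\<sigma>. 0) \<in> cochains p X"
  by (simp add: cochains_def)

lemma cochains_add: "a \<in> cochains p X \<Longrightarrow> b \<in> cochains p X \<Longrightarrow> (\<lambda>\<sigma>. a \<sigma> + b \<sigma>) \<in> cochains p X"
  by (simp add: cochains_def)

lemma coboundaries_zero: "(\<lambda>\<sigma>. 0) \<in> coboundaries p X"
  by (cases p) (auto simp: coboundaries_def intro!: image_eqI[where x = "\<lambda>\<sigma>. 0"])

lemma coboundaries_add: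
  "a \<in> coboundaries p X \<Longrightarrow> b \<in> coboundaries p X \<Longrightarrow> (\<lambda>\<sigma>. a \<sigma> + b \<sigma>) \<in> coboundaries p X"
  by (cases p) (auto simp: coboundaries_def coboundary_add[symmetric] intro!: imageI cochains_add)

text \<open>In positive degree this is \<open>coboundary_coboundary\<close>; in degree 0 the only
  coboundary is zero.\<close>

lemma coboundaries_subset_cocycles: "coboundaries p X \<subseteq> carrier (cocycle_group p X)"
  by (cases p) (auto simp: coboundaries_def cocycle_group_def coboundary_mem_cochains)

lemma mult_cocycle_group [simp]: "a \<otimes>\<^bsub>cocycle_group p X\<^esub> b = (\<lambda>\<sigma>. a \<sigma> + b \<sigma>)"
  by (simp add: cocycle_group_def cochain_group_def)

lemma one_cocycle_group [simp]: "\<one>\<^bsub>cocycle_group p X\<^esub> = (\<lambda>\<sigma>. 0)"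
  by (simp add: cocycle_group_def cochain_group_def)

lemma carrier_cocycle_group:
  "carrier (cocycle_group p X) = {c \<in> cochains p X. coboundary p X c = (\<lambda>\<sigma>. 0)}"
  by (simp add: cocycle_group_def)

lemma comm_group_cocycle_group: "comm_group (cocycle_group p X)"
proof (rule comm_groupI)
  fix a assume "a \<in> carrier (cocycle_group p X)"
  then show "\<exists>b\<in>carrier (cocycle_group p X). b \<otimes>\<^bsub>cocycle_group p X\<^esub> a = \<one>\<^bsub>cocycle_group p X\<^esub>"
    by (intro bexI[of _ a]) simp_all
qed (auto simp: carrier_cocycle_group cochains_add coboundary_add add.assoc add.commute)

lemma normal_coboundaries: "coboundaries p X \<lhd> cocycle_group p X"
proof -
  interpret comm_group "cocycle_group p X" by (rule comm_group_cocycle_group)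
  \<comment> \<open>Modulo 2 every cocycle is its own inverse, so closure under inverses is
    automatic.\<close>
  have "inv\<^bsub>cocycle_group p X\<^esub> a = a" if "a \<in> carrier (cocycle_group p X)" for a
    using that by (intro inv_equality) auto
  then have "subgroup (coboundaries p X) (cocycle_group p X)"
    using coboundaries_subset_cocycles[of p X]
    by unfold_locales (auto simp: coboundaries_add coboundaries_zero)
  then show ?thesis by (rule subgroup_imp_normal)
qed

lemma group_cohomology_group: "group (cohomology_group p X)"
  unfolding cohomology_group_def by (rule normal.factorgroup_is_group[OF normal_coboundaries])

lemma mem_coboundary_hull:
  "c \<in> coboundary_hull p X A \<longleftrightarrow> (\<exists>b\<in>coboundaries p X. \<exists>a\<in>A. c = (\<lambda>\<sigma>. b \<sigma> + a \<sigma>))"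
  by (simp add: coboundary_hull_def set_mult_def cochain_group_def)

lemma coboundary_hullI:
  "b \<in> coboundaries p X \<Longrightarrow> a \<in> A \<Longrightarrow> (\<lambda>\<sigma>. b \<sigma> + a \<sigma>) \<in> coboundary_hull p X A"
  unfolding mem_coboundary_hull by blast

lemma one_cohomology_group: "\<one>\<^bsub>cohomology_group p X\<^esub> = coboundary_hull p X {\<lambda>\<sigma>. 0}"
  by (auto simp: cohomology_group_def FactGroup_def mem_coboundary_hull)

text \<open>Presents each class as the hull of one cocycle, so that claims about classes reduce to
  claims about representatives.\<close>

lemma carrier_cohomology_group:
  "carrier (cohomology_group p X) = (\<lambda>c. coboundary_hull p X {c}) ` carrier (cocycle_group p X)"
  by (auto simp: cohomology_group_def FactGroup_def RCOSETS_def r_coset_eq_set_mult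
      coboundary_hull_def set_mult_def cocycle_group_def)

lemma mult_cohomology_group:
  assumes "a \<in> carrier (cocycle_group p X)" "b \<in> carrier (cocycle_group p X)"
  shows "coboundary_hull p X {a} \<otimes>\<^bsub>cohomology_group p X\<^esub> coboundary_hull p X {b} =
         coboundary_hull p X {\<lambda>\<sigma>. a \<sigma> + b \<sigma>}"
proof -
  \<comment> \<open>The hull multiplies in \<open>cochain_group\<close>, the coset in
    \<open>cocycle_group\<close>; the two differ only in their carriers.\<close>
  have hull: "coboundary_hull p X {c} = coboundaries p X #>\<^bsub>cocycle_group p X\<^esub> c" for c
    by (simp add: r_coset_eq_set_mult coboundary_hull_def set_mult_def cocycle_group_def)
  show ?thesis
    using normal.rcos_sum[OF normal_coboundaries assms] by (simp add: hull cohomology_group_def)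
qed

section \<open>Induced maps\<close>

text \<open>In \<open>h (b' + a) = h b' + h a\<close> the first summand is again a coboundary, which
  the outer hull absorbs. Serves both pullback and scaling.\<close>

lemma coboundary_hull_transfer:
  assumes add: "\<And>a b. h (\<lambda>\<sigma>. a \<sigma> + b \<sigma>) = (\<lambda>\<sigma>. h a \<sigma> + h b \<sigma>)"
    and hull: "\<And>b. b \<in> coboundaries p Y \<Longrightarrow> h b \<in> coboundaries p X"
  shows "coboundary_hull p X (h ` coboundary_hull p Y A) = coboundary_hull p X (h ` A)"
proof (intro equalityI subsetI)
  fix c assume "c \<in> coboundary_hull p X (h ` coboundary_hull p Y A)"
  from this[unfolded mem_coboundary_hull[of c]] obtain b a'
    where b: "b \<in> coboundaries p X" "c = (\<lambda>\<sigma>. b \<sigma> + h a' \<sigma>)"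
      and "a' \<in> coboundary_hull p Y A"
    by blast
  from this(3)[unfolded mem_coboundary_hull] obtain b' a
    where a: "b' \<in> coboundaries p Y" "a \<in> A" "a' = (\<lambda>\<sigma>. b' \<sigma> + a \<sigma>)"
    by blast
  have "c = (\<lambda>\<sigma>. (b \<sigma> + h b' \<sigma>) + h a \<sigma>)"
    unfolding b(2) a(3) add by (simp only: add.assoc)
  then show "c \<in> coboundary_hull p X (h ` A)"
    using coboundary_hullI[OF coboundaries_add[OF b(1) hull[OF a(1)]] imageI[OF a(2)]] by simp
next
  fix c assume "c \<in> coboundary_hull p X (h ` A)"
  from this[unfolded mem_coboundary_hull] obtain b a
    where *: "b \<in> coboundaries p X" "a \<in> A" "c = (\<lambda>\<sigma>. b \<sigma> + h a \<sigma>)"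
    by blast
  \<comment> \<open>The zero coboundary puts \<open>A\<close> inside its own hull.\<close>
  have "a \<in> coboundary_hull p Y A"
    using coboundary_hullI[OF coboundaries_zero *(2)] by simp
  then show "c \<in> coboundary_hull p X (h ` coboundary_hull p Y A)"
    unfolding *(3) by (intro coboundary_hullI *(1) imageI)
qed

section \<open>Pullback of cochains and functoriality\<close>

lemma cochain_pullback_add:
  "cochain_pullback p X f (\<lambda>\<sigma>. a \<sigma> + b \<sigma>) =
   (\<lambda>\<sigma>. cochain_pullback p X f a \<sigma> + cochain_pullback p X f b \<sigma>)"
  by (auto simp: cochain_pullback_def)

lemma cochain_pullback_mem_cochains: "cochain_pullback p X f c \<in> cochains p X"
  by (simp add: cochain_pullback_def cochains_def)

lemma cochain_pullback_zero [simp]: "cochain_pullback p X f (\<lambda>\<sigma>. 0) = (\<lambda>\<sigma>. 0)"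
  by (auto simp: cochain_pullback_def)

text \<open>Faces precompose and \<open>simplex_map\<close> postcomposes, so the two commute and
  pullback is a cochain map.\<close>

lemma coboundary_cochain_pullback:
  assumes "continuous_map X Y f"
  shows "coboundary p X (cochain_pullback p X f c) = cochain_pullback (Suc p) X f (coboundary p Y c)"
proof
  fix \<sigma>
  show "coboundary p X (cochain_pullback p X f c) \<sigma> =
      cochain_pullback (Suc p) X f (coboundary p Y c) \<sigma>"
  proof (cases "singular_simplex (Suc p) X \<sigma>")
    case True
    have "singular_face (Suc p) k (simplex_map (Suc p) f \<sigma>) = simplex_map p f (singular_face (Suc p) k \<sigma>)"
      if "k \<le> Suc p" for k
      using that by (auto simp: singular_face_def simplex_map_def simplical_face_in_standard_simplex)
    moreover have "singular_simplex p X (singular_face (Suc p) k \<sigma>)" if "k \<le> Suc p" for k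
      using singular_simplex_singular_face[OF True] that by simp
    ultimately show ?thesis
      using True singular_simplex_simplex_map[OF True assms]
      by (simp add: coboundary_def cochain_pullback_def del: sum.atMost_Suc)
  qed (simp add: coboundary_def cochain_pullback_def)
qed

lemma cochain_pullback_coboundaries:
  assumes "continuous_map X Y f" "b \<in> coboundaries p Y"
  shows "cochain_pullback p X f b \<in> coboundaries p X"
  using assms(2)
  by (cases p) (auto simp: coboundaries_def coboundary_cochain_pullback[OF assms(1), symmetric]
      intro!: imageI cochain_pullback_mem_cochains)

lemma cochain_pullback_cocycle:
  assumes "continuous_map X Y f" "c \<in> carrier (cocycle_group p Y)"
  shows "cochain_pullback p X f c \<in> carrier (cocycle_group p X)"
  using assms
  by (simp add: carrier_cocycle_group coboundary_cochain_pullback cochain_pullback_mem_cochains)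

text \<open>For a singleton \<open>A\<close> this evaluates the induced map on a class through one
  representative.\<close>

lemma cohomology_induced_coboundary_hull:
  assumes "continuous_map X Y f"
  shows "cohomology_induced p X f (coboundary_hull p Y A) =
         coboundary_hull p X (cochain_pullback p X f ` A)"
  unfolding cohomology_induced_def
  by (intro coboundary_hull_transfer cochain_pullback_add cochain_pullback_coboundaries[OF assms])

lemma cochain_pullback_cochain_pullback:
  assumes "continuous_map X Y f" "\<And>x. x \<in> topspace X \<Longrightarrow> g (f x) = h x"
  shows "cochain_pullback p X f (cochain_pullback p Y g c) = cochain_pullback p X h c"
proof
  fix \<sigma>
  show "cochain_pullback p X f (cochain_pullback p Y g c) \<sigma> = cochain_pullback p X h c \<sigma>"
  proof (cases "singular_simplex p X \<sigma>")
    case True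
    have "simplex_map p g (simplex_map p f \<sigma>) = simplex_map p (g \<circ> f) \<sigma>"
      by (simp add: simplex_map_compose)
    \<comment> \<open>Singular simplices of \<open>X\<close> take values in its topspace, where
      \<open>g \<circ> f\<close> and \<open>h\<close> agree.\<close>
    also have "\<dots> = simplex_map p h \<sigma>"
      using True assms(2) by (auto intro: simplex_map_eq)
    finally show ?thesis
      using True singular_simplex_simplex_map[OF True assms(1)] by (simp add: cochain_pullback_def)
  qed (simp add: cochain_pullback_def)
qed

text \<open>Functoriality, with \<open>h\<close> kept separate from \<open>g \<circ> f\<close> so
  that it applies to maps agreeing only on \<open>X\<close>, such as a classifying map and its
  restriction.\<close>

lemma cohomology_induced_compose:
  assumes "continuous_map X Y f" "\<And>x. x \<in> topspace X \<Longrightarrow> g (f x) = h x"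
  shows "cohomology_induced p X f (cohomology_induced p Y g A) = cohomology_induced p X h A"
proof -
  have "cochain_pullback p X f ` cochain_pullback p Y g ` A = cochain_pullback p X h ` A"
    unfolding image_image
    using assms by (intro image_cong refl cochain_pullback_cochain_pullback)
  then show ?thesis
    \<comment> \<open>Only the inner map and the right-hand side are unfolded; the outer map keeps
      the form that the inserted equation rewrites.\<close>
    using cohomology_induced_coboundary_hull[OF assms(1)] by (simp only: cohomology_induced_def[of _ Y]
        cohomology_induced_def[of _ X h])
qed

lemma induced_map_compose:
  assumes "continuous_map X Y f" "\<And>x. x \<in> topspace X \<Longrightarrow> g (f x) = h x"
  shows "induced_map X f (induced_map Y g x) = induced_map X h x"
  unfolding induced_map_def using assms by (simp add: cohomology_induced_compose)

lemma cohomology_induced_hom: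
  assumes "continuous_map X Y f"
  shows "cohomology_induced p X f \<in> hom (cohomology_group p Y) (cohomology_group p X)"
proof (rule homI)
  fix x assume "x \<in> carrier (cohomology_group p Y)"
  then show "cohomology_induced p X f x \<in> carrier (cohomology_group p X)"
    using assms
    by (auto simp: carrier_cohomology_group cohomology_induced_coboundary_hull cochain_pullback_cocycle)
next
  fix x y assume "x \<in> carrier (cohomology_group p Y)" "y \<in> carrier (cohomology_group p Y)"
  then obtain a b where ab: "a \<in> carrier (cocycle_group p Y)" "x = coboundary_hull p Y {a}"
      "b \<in> carrier (cocycle_group p Y)" "y = coboundary_hull p Y {b}"
    by (auto simp: carrier_cohomology_group)
  then show "cohomology_induced p X f (x \<otimes>\<^bsub>cohomology_group p Y\<^esub> y) =
      cohomology_induced p X f x \<otimes>\<^bsub>cohomology_group p X\<^esub> cohomology_induced p X f y"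
    using assms
    by (simp add: mult_cohomology_group cohomology_induced_coboundary_hull cochain_pullback_cocycle
        cochain_pullback_add)
qed

lemma cohomology_induced_one:
  assumes "continuous_map X Y f"
  shows "cohomology_induced p X f \<one>\<^bsub>cohomology_group p Y\<^esub> = \<one>\<^bsub>cohomology_group p X\<^esub>"
  using assms by (simp add: one_cohomology_group cohomology_induced_coboundary_hull)

lemma cohomology_induced_scale:
  assumes "continuous_map X Y f"
  shows "cohomology_induced p X f (cohomology_scale p Y r A) =
         cohomology_scale p X r (cohomology_induced p X f A)"
proof -
  \<comment> \<open>A scalar is 0 or 1, so scaling preserves coboundaries and
    \<open>coboundary_hull_transfer\<close> applies to it within \<open>X\<close>.\<close>
  have "(\<lambda>\<sigma>. r * b \<sigma>) \<in> coboundaries p X" if "b \<in> coboundaries p X" for b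
    using that coboundaries_zero by (cases r) simp_all
  then have "cohomology_scale p X r (cohomology_induced p X f A) =
      coboundary_hull p X ((\<lambda>c \<sigma>. r * c \<sigma>) ` cochain_pullback p X f ` A)"
    unfolding cohomology_scale_def cohomology_induced_def
    by (intro coboundary_hull_transfer) (auto simp: distrib_left)
  also have "(\<lambda>c \<sigma>. r * c \<sigma>) ` cochain_pullback p X f ` A =
      cochain_pullback p X f ` (\<lambda>c \<sigma>. r * c \<sigma>) ` A"
    by (auto simp: image_image cochain_pullback_def intro!: image_cong)
  finally show ?thesis
    using assms by (simp add: cohomology_scale_def cohomology_induced_coboundary_hull)
qed

section \<open>Total cohomology as a direct sum over degrees\<close>

lemma carrier_cohomology:
  "carrier (cohomology X) =
   {x. (\<forall>p. x p \<in> carrier (cohomology_group p X)) \<and> finite {p. x p \<noteq> \<one>\<^bsub>cohomology_group p X\<^esub>}}"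
  by (auto simp: cohomology_def carrier_sum_group group_cohomology_group PiE_iff)

lemma mult_cohomology: "x \<otimes>\<^bsub>cohomology X\<^esub> y = (\<lambda>p. x p \<otimes>\<^bsub>cohomology_group p X\<^esub> y p)"
  by (simp add: cohomology_def restrict_UNIV)

lemma cohomology_linear_induced_map:
  assumes "continuous_map X Y f"
  shows "cohomology_linear Y X (induced_map X f)"
  unfolding cohomology_linear_def
proof (intro conjI homI allI ballI)
  fix x assume x: "x \<in> carrier (cohomology Y)"
  \<comment> \<open>Identities go to identities, so the support can only shrink and stays
    finite.\<close>
  have "{p. induced_map X f x p \<noteq> \<one>\<^bsub>cohomology_group p X\<^esub>} \<subseteq> {p. x p \<noteq> \<one>\<^bsub>cohomology_group p Y\<^esub>}"
    using cohomology_induced_one[OF assms] by (auto simp: induced_map_def)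
  moreover have "induced_map X f x p \<in> carrier (cohomology_group p X)" for p
    unfolding induced_map_def using x
    by (intro hom_in_carrier[OF cohomology_induced_hom[OF assms]]) (simp add: carrier_cohomology)
  ultimately show "induced_map X f x \<in> carrier (cohomology X)"
    using x by (simp add: carrier_cohomology finite_subset)
next
  fix x y assume "x \<in> carrier (cohomology Y)" "y \<in> carrier (cohomology Y)"
  then show "induced_map X f (x \<otimes>\<^bsub>cohomology Y\<^esub> y) =
      induced_map X f x \<otimes>\<^bsub>cohomology X\<^esub> induced_map X f y"
    using hom_mult[OF cohomology_induced_hom[OF assms]]
    by (simp add: carrier_cohomology mult_cohomology induced_map_def)
next
  fix r x
  show "induced_map X f (scale Y r x) = scale X r (induced_map X f x)"
    using assms by (simp add: induced_map_def scale_def cohomology_induced_scale)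
qed

lemma induced_map_in_degree:
  assumes "continuous_map X Y f"
  shows "induced_map X f (in_degree p Y A) = in_degree p X (cohomology_induced p X f A)"
  by (rule ext) (simp add: induced_map_def in_degree_def cohomology_induced_one[OF assms])

section \<open>Interleavings\<close>

text \<open>The source of all interleaving identities: pulling back along inclusions gives the same
  result through any intermediate \<open>B\<close>, whether it belongs to \<open>X\<close> or to
  \<open>Y\<close>.\<close>

lemma restriction_map_restriction_map:
  assumes "A \<subseteq> B"
  shows "induced_map (top_of_set A) id (induced_map (top_of_set B) id x) =
         induced_map (top_of_set A) id x"
  by (rule induced_map_compose) (use assms in auto)

text \<open>The inclusion of \<open>X s\<close> followed by \<open>q t\<close> is
  \<open>p s\<close>, so functoriality identifies the two pullbacks of the universal class.\<close>

lemma restrict_persistent_stiefel_whitney: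
  assumes "X s \<subseteq> Y t" "\<And>x. x \<in> X s \<Longrightarrow> q t x = p s x"
  shows "induced_map (top_of_set (X s)) id (persistent_stiefel_whitney d Y q i t) =
         persistent_stiefel_whitney d X p i s"
proof -
  have "continuous_map (top_of_set (X s)) (top_of_set (Y t)) id"
    using assms(1) by auto
  note induced_map_in_degree[OF this] cohomology_induced_compose[OF this, of "q t" "p s"]
  then show ?thesis
    unfolding persistent_stiefel_whitney_def
    using assms(2) by simp
qed

theorem theorem3p3:
  fixes X Y :: "real \<Rightarrow> 'e::euclidean_space set"
    and p q :: "real \<Rightarrow> 'e \<Rightarrow> (nat \<Rightarrow>\<^sub>0 real) set"
    and T U :: "real set" and d :: nat and \<epsilon> :: real
  assumes "\<epsilon> \<ge> 0"
    and "vector_bundle_filtration d T X p"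
    and "vector_bundle_filtration d U Y q"
    and "interleaved \<epsilon> T X p U Y q"
  shows "\<exists>\<phi> \<psi>. cohomology_interleaving \<epsilon> T X U Y \<phi> \<psi> \<and>
    (\<forall>i \<in> {1..d}.
       (\<forall>t \<in> (\<lambda>r. r + \<epsilon>) ` T \<inter> U.
          \<phi> t (persistent_stiefel_whitney d Y q i t) = persistent_stiefel_whitney d X p i (t - \<epsilon>)) \<and>
       (\<forall>s \<in> (\<lambda>r. r + \<epsilon>) ` U \<inter> T.
          \<psi> s (persistent_stiefel_whitney d X p i s) = persistent_stiefel_whitney d Y q i (s - \<epsilon>)))"
proof -
  \<comment> \<open>Inclusions are represented by \<open>id\<close>: \<open>\<phi> t\<close> comes
    from \<open>X (t - \<epsilon>) \<subseteq> Y t\<close>, and \<open>\<psi> s\<close> from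
    \<open>Y (s - \<epsilon>) \<subseteq> X s\<close>.\<close>
  define \<phi> where "\<phi> t = induced_map (top_of_set (X (t - \<epsilon>))) id" for t
  define \<psi> where "\<psi> s = induced_map (top_of_set (Y (s - \<epsilon>))) id" for s
  have filtered: "\<And>s t. s \<in> T \<Longrightarrow> t \<in> T \<Longrightarrow> s \<le> t \<Longrightarrow> X s \<subseteq> X t"
      "\<And>s t. s \<in> U \<Longrightarrow> t \<in> U \<Longrightarrow> s \<le> t \<Longrightarrow> Y s \<subseteq> Y t"
    using assms(2,3) unfolding vector_bundle_filtration_def filtration_def by blast+
  have XY: "X (t - \<epsilon>) \<subseteq> Y t" "\<And>x. x \<in> X (t - \<epsilon>) \<Longrightarrow> q t x = p (t - \<epsilon>) x"
    if "t \<in> (\<lambda>r. r + \<epsilon>) ` T \<inter> U" for t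
  proof -
    \<comment> \<open>\<open>interleaved\<close> is indexed by the parameter before the shift, hence
      its use at \<open>t - \<epsilon>\<close>.\<close>
    have "t - \<epsilon> \<in> T \<inter> (\<lambda>u. u - \<epsilon>) ` U" using that by auto
    then have "X (t - \<epsilon>) \<subseteq> Y (t - \<epsilon> + \<epsilon>) \<and> (\<forall>x \<in> X (t - \<epsilon>). q (t - \<epsilon> + \<epsilon>) x = p (t - \<epsilon>) x)"
      using assms(4) unfolding interleaved_def by blast
    then show "X (t - \<epsilon>) \<subseteq> Y t" "\<And>x. x \<in> X (t - \<epsilon>) \<Longrightarrow> q t x = p (t - \<epsilon>) x" by simp_all
  qed
  have YX: "Y (s - \<epsilon>) \<subseteq> X s" "\<And>y. y \<in> Y (s - \<epsilon>) \<Longrightarrow> p s y = q (s - \<epsilon>) y"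
    if "s \<in> (\<lambda>r. r + \<epsilon>) ` U \<inter> T" for s
  proof -
    have "s - \<epsilon> \<in> U \<inter> (\<lambda>t. t - \<epsilon>) ` T" using that by auto
    then have "Y (s - \<epsilon>) \<subseteq> X (s - \<epsilon> + \<epsilon>) \<and> (\<forall>y \<in> Y (s - \<epsilon>). p (s - \<epsilon> + \<epsilon>) y = q (s - \<epsilon>) y)"
      using assms(4) unfolding interleaved_def by blast
    then show "Y (s - \<epsilon>) \<subseteq> X s" "\<And>y. y \<in> Y (s - \<epsilon>) \<Longrightarrow> p s y = q (s - \<epsilon>) y" by simp_all
  qed
  have "cohomology_interleaving \<epsilon> T X U Y \<phi> \<psi>"
    unfolding cohomology_interleaving_def
  proof (intro conjI ballI allI impI)
    fix t assume "t \<in> (\<lambda>r. r + \<epsilon>) ` T \<inter> U"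
    from XY(1)[OF this] show "cohomology_linear (top_of_set (Y t)) (top_of_set (X (t - \<epsilon>))) (\<phi> t)"
      unfolding \<phi>_def by (intro cohomology_linear_induced_map) auto
  next
    fix s assume "s \<in> (\<lambda>r. r + \<epsilon>) ` U \<inter> T"
    from YX(1)[OF this] show "cohomology_linear (top_of_set (X s)) (top_of_set (Y (s - \<epsilon>))) (\<psi> s)"
      unfolding \<psi>_def by (intro cohomology_linear_induced_map) auto
  next
    fix t t' y
    assume *: "t \<in> (\<lambda>r. r + \<epsilon>) ` T \<inter> U" "t' \<in> (\<lambda>r. r + \<epsilon>) ` T \<inter> U" "t \<le> t'"
    then have "X (t - \<epsilon>) \<subseteq> X (t' - \<epsilon>)" by (intro filtered(1)) auto
    \<comment> \<open>Both sides are the pullback of \<open>y\<close> to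
      \<open>X (t - \<epsilon>)\<close>, the left one through \<open>Y t\<close>, the right one
      through \<open>X (t' - \<epsilon>)\<close>.\<close>
    then show "\<phi> t (restriction_map Y t' t y) = restriction_map X (t' - \<epsilon>) (t - \<epsilon>) (\<phi> t' y)"
      unfolding \<phi>_def restriction_map_def using XY(1)[OF *(1)]
      by (simp add: restriction_map_restriction_map)
  next
    fix s s' x
    assume *: "s \<in> (\<lambda>r. r + \<epsilon>) ` U \<inter> T" "s' \<in> (\<lambda>r. r + \<epsilon>) ` U \<inter> T" "s \<le> s'"
    then have "Y (s - \<epsilon>) \<subseteq> Y (s' - \<epsilon>)" by (intro filtered(2)) auto
    then show "\<psi> s (restriction_map X s' s x) = restriction_map Y (s' - \<epsilon>) (s - \<epsilon>) (\<psi> s' x)"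
      unfolding \<psi>_def restriction_map_def using YX(1)[OF *(1)]
      by (simp add: restriction_map_restriction_map)
  next
    fix t x
    assume "t \<in> (\<lambda>r. r + \<epsilon>) ` U \<inter> T \<and> t - \<epsilon> \<in> (\<lambda>r. r + \<epsilon>) ` T \<inter> U"
    \<comment> \<open>The composite passes through \<open>Y (t - \<epsilon>)\<close>, which contains
      \<open>X (t - 2 * \<epsilon>)\<close>.\<close>
    then show "\<phi> (t - \<epsilon>) (\<psi> t x) = restriction_map X t (t - 2 * \<epsilon>) x"
      unfolding \<phi>_def \<psi>_def restriction_map_def using XY(1)[of "t - \<epsilon>"]
      by (simp add: restriction_map_restriction_map)
  next
    fix t y
    assume "t \<in> (\<lambda>r. r + \<epsilon>) ` T \<inter> U \<and> t - \<epsilon> \<in> (\<lambda>r. r + \<epsilon>) ` U \<inter> T"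
    then show "\<psi> (t - \<epsilon>) (\<phi> t y) = restriction_map Y t (t - 2 * \<epsilon>) y"
      unfolding \<phi>_def \<psi>_def restriction_map_def using YX(1)[of "t - \<epsilon>"]
      by (simp add: restriction_map_restriction_map)
  qed
  moreover have "\<phi> t (persistent_stiefel_whitney d Y q i t) = persistent_stiefel_whitney d X p i (t - \<epsilon>)"
    if "t \<in> (\<lambda>r. r + \<epsilon>) ` T \<inter> U" for i t
    unfolding \<phi>_def using XY[OF that] by (rule restrict_persistent_stiefel_whitney)
  moreover have "\<psi> s (persistent_stiefel_whitney d X p i s) = persistent_stiefel_whitney d Y q i (s - \<epsilon>)"
    if "s \<in> (\<lambda>r. r + \<epsilon>) ` U \<inter> T" for i s
    unfolding \<psi>_def using YX[OF that] by (rule restrict_persistent_stiefel_whitney)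
  ultimately show ?thesis by blast
qed

end
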